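(* Let $G$ be a torsion-free abelian group and let $R=\bigoplus_{n\in G}R_n$ be a $G$-graded commutative ring. Then the Jacobson radical of $R$ is a graded ideal.
   Context: Rings have an identity. A $G$-graded ring is a ring $R$ with a decomposition $R=\bigoplus_{n\in G}R_n$ of its additive group into subgroups with $R_mR_n\subseteq R_{m+n}$ for all $m,n\in G$. An ideal $I$ is graded if for every $f=\sum_n r_n\in I$ with $r_n\in R_n$, all $r_n$ lie in $I$. *)

theory Defs
  imports "HOL-Algebra.Algebra"
begin

text \<open>The grading group is written multiplicatively, following HOL-Algebra: the degree written
  \<open>m + n\<close> on paper is \<open>m \<otimes>\<^bsub>G\<^esub> n\<close>, and \<open>k n\<close> is \<open>n [^]\<^bsub>G\<^esub> k\<close>.\<close>

definition torsion_free :: "('g, 'm) monoid_scheme \<Rightarrow> bool" where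
  "torsion_free G \<longleftrightarrow>
    (\<forall>n\<in>carrier G. \<forall>k::nat. k > 0 \<longrightarrow> n [^]\<^bsub>G\<^esub> k = \<one>\<^bsub>G\<^esub> \<longrightarrow> n = \<one>\<^bsub>G\<^esub>)"

text \<open>Families \<open>(r n)\<close> with \<open>r n \<in> A n\<close> and finite support; they are extensional outside the
  carrier of \<open>G\<close>, so that uniqueness of a family is meaningful.\<close>

definition component_families ::
    "('g, 'm) monoid_scheme \<Rightarrow> ('a, 'r) ring_scheme \<Rightarrow> ('g \<Rightarrow> 'a set) \<Rightarrow> ('g \<Rightarrow> 'a) set" where
  "component_families G R A =
    {r \<in> \<Pi>\<^sub>E n\<in>carrier G. A n. finite {n \<in> carrier G. r n \<noteq> \<zero>\<^bsub>R\<^esub>}}"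

text \<open>The restriction to the support is needed because \<open>finsum\<close> is \<open>\<zero>\<close> on infinite sets.\<close>

definition family_sum ::
    "('g, 'm) monoid_scheme \<Rightarrow> ('a, 'r) ring_scheme \<Rightarrow> ('g \<Rightarrow> 'a) \<Rightarrow> 'a" where
  "family_sum G R r = (\<Oplus>\<^bsub>R\<^esub>n\<in>{n \<in> carrier G. r n \<noteq> \<zero>\<^bsub>R\<^esub>}. r n)"

locale graded_ring = G: comm_group G + R: ring R
  for G :: "('g, 'm) monoid_scheme" and R :: "('a, 'r) ring_scheme" +
  fixes A :: "'g \<Rightarrow> 'a set"
  assumes component_subgroup: "n \<in> carrier G \<Longrightarrow> additive_subgroup (A n) R"
    and direct_sum: "x \<in> carrier R \<Longrightarrow> \<exists>!r. r \<in> component_families G R A \<and> x = family_sum G R r"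
    and component_mult:
      "\<lbrakk>m \<in> carrier G; n \<in> carrier G; a \<in> A m; b \<in> A n\<rbrakk> \<Longrightarrow> a \<otimes>\<^bsub>R\<^esub> b \<in> A (m \<otimes>\<^bsub>G\<^esub> n)"

definition (in graded_ring) graded_ideal :: "'a set \<Rightarrow> bool" where
  "graded_ideal I \<longleftrightarrow> ideal I R \<and>
    (\<forall>r\<in>component_families G R A. family_sum G R r \<in> I \<longrightarrow> (\<forall>n\<in>carrier G. r n \<in> I))"

text \<open>The intersection with the carrier makes the radical of the zero ring, which has no
  maximal ideals, the whole ring.\<close>

definition (in cring) jacobson_radical :: "'a set" where
  "jacobson_radical = carrier R \<inter> \<Inter>{M. maximalideal M R}"

end

theory Submission
  imports Defs
begin

text \<open>A torsion-free abelian group carries a translation-invariant total order. Let \<open>M\<close> be a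
  prime ideal of \<open>R\<close>, not necessarily graded. If \<open>x y = 1\<close>, then multiplying the components of
  \<open>x\<close> and \<open>y\<close> of extremal degree among those outside \<open>M\<close> shows that \<open>x\<close> has only one
  component outside \<open>M\<close>. Now let \<open>f\<close> be in the Jacobson radical, \<open>M\<close> maximal, and suppose
  \<open>s = f\<^sub>n \<notin> M\<close> with \<open>n \<noteq> 0\<close>. The unit \<open>1 + s f\<close> has the component \<open>s\<^sup>2 \<notin> M\<close> in degree
  \<open>2n\<close>, so its component \<open>1 + s t\<close> in degree \<open>0\<close> lies in \<open>M\<close>, where \<open>t\<close> is the component
  of \<open>f\<close> in degree \<open>-n\<close>; hence \<open>t \<notin> M\<close>. But then the unit \<open>1 + s\<^sup>2 f\<close> has the two
  components \<open>s\<^sup>3\<close> and \<open>s\<^sup>2 t\<close> outside \<open>M\<close>, in degrees \<open>3n\<close> and \<open>n\<close>, a contradiction. So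
  all components of nonzero degree lie in \<open>M\<close>, and with \<open>f\<close> so does the remaining one.\<close>

section \<open>Orders on torsion-free abelian groups\<close>

definition translation_order :: "('g, 'm) monoid_scheme \<Rightarrow> ('g \<Rightarrow> 'g \<Rightarrow> bool) \<Rightarrow> bool" where
  "translation_order G lt \<longleftrightarrow>
    asymp_on (carrier G) lt \<and> transp_on (carrier G) lt \<and> totalp_on (carrier G) lt \<and>
    (\<forall>x\<in>carrier G. \<forall>y\<in>carrier G. \<forall>z\<in>carrier G.
      lt x y \<longrightarrow> lt (z \<otimes>\<^bsub>G\<^esub> x) (z \<otimes>\<^bsub>G\<^esub> y))"

text \<open>Turns statements about greatest degrees into statements about least degrees.\<close>

lemma translation_order_converse:
  assumes "translation_order G lt"
  shows "translation_order G (conversep lt)"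
  using assms by (simp add: translation_order_def)

text \<open>The elements \<open>\<ge> \<one>\<close> of a translation-invariant partial order; the
  condition on inverses is antisymmetry.\<close>

definition (in comm_group) pointed_cone :: "'a set \<Rightarrow> bool" where
  "pointed_cone P \<longleftrightarrow> submonoid P G \<and> (\<forall>x\<in>P. inv x \<in> P \<longrightarrow> x = \<one>)"

section \<open>Extension of pointed cones\<close>

lemma (in comm_group) submonoid_adjoin:
  assumes "submonoid P G" and h: "h \<in> carrier G"
  shows "submonoid {p \<otimes> h [^] (k::nat) | p k. p \<in> P} G"
proof
  interpret P: submonoid P G by fact
  let ?Q = "{p \<otimes> h [^] (k::nat) | p k. p \<in> P}"
  show "?Q \<subseteq> carrier G" using h P.mem_carrier by auto
  show "\<one> \<in> ?Q"
  proof -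
    have "\<one> = \<one> \<otimes> h [^] (0::nat)" by simp
    then show ?thesis using P.one_closed by blast
  qed
  fix x y assume "x \<in> ?Q" "y \<in> ?Q"
  then obtain p k q l where x: "x = p \<otimes> h [^] (k::nat)" "p \<in> P"
    and y: "y = q \<otimes> h [^] (l::nat)" "q \<in> P" by auto
  have "x \<otimes> y = (p \<otimes> q) \<otimes> h [^] (k + l)"
    using x y h P.mem_carrier by (simp add: m_ac nat_pow_mult[symmetric])
  then show "x \<otimes> y \<in> ?Q" using x y P.m_closed by blast
qed

text \<open>The cone obtained by adjoining \<open>h\<close> is not pointed, which gives an equation
  \<open>p h\<^sup>k q h\<^sup>l = 1\<close> with \<open>p, q \<in> P\<close> and \<open>k + l > 0\<close>.\<close>

lemma (in comm_group) maximal_pointed_cone_power: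
  assumes P: "pointed_cone P"
    and max: "\<And>Q. \<lbrakk>pointed_cone Q; P \<subseteq> Q\<rbrakk> \<Longrightarrow> Q = P"
    and h: "h \<in> carrier G" "h \<notin> P"
  obtains k :: nat where "k > 0" "inv (h [^] k) \<in> P"
proof -
  interpret P: submonoid P G using P by (simp add: pointed_cone_def)
  define Q where "Q = {p \<otimes> h [^] (k::nat) | p k. p \<in> P}"
  have Q: "submonoid Q G" unfolding Q_def by (rule submonoid_adjoin[OF P.submonoid_axioms h(1)])
  have QI: "p \<otimes> h [^] (k::nat) \<in> Q" if "p \<in> P" for p k using that by (auto simp: Q_def)
  have PQ: "P \<subseteq> Q"
  proof
    show "p \<in> Q" if "p \<in> P" for p using QI[OF that, of 0] P.mem_carrier[OF that] by simp
  qed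
  have "h \<in> Q" using QI[OF P.one_closed, of 1] h(1) by simp
  then have "\<not> pointed_cone Q" using max[OF _ PQ] h(2) by auto
  then obtain x where x: "x \<in> Q" "inv x \<in> Q" "x \<noteq> \<one>" using Q by (auto simp: pointed_cone_def)
  obtain p k where pk: "x = p \<otimes> h [^] (k::nat)" "p \<in> P" using x(1) by (auto simp: Q_def)
  obtain q l where ql: "inv x = q \<otimes> h [^] (l::nat)" "q \<in> P" using x(2) by (auto simp: Q_def)
  have pq: "p \<in> carrier G" "q \<in> carrier G" using pk(2) ql(2) by (simp_all add: P.mem_carrier)
  have xc: "x \<in> carrier G" using pq h by (simp add: pk(1))
  have "x \<otimes> inv x = (p \<otimes> h [^] k) \<otimes> (q \<otimes> h [^] l)"
    by (subst ql(1)) (simp only: pk(1))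
  also have "\<dots> = (p \<otimes> q) \<otimes> h [^] (k + l)"
    using pq h by (simp add: m_ac nat_pow_mult[symmetric])
  finally have "x \<otimes> inv x = (p \<otimes> q) \<otimes> h [^] (k + l)" .
  then have one: "(p \<otimes> q) \<otimes> h [^] (k + l) = \<one>" using r_inv[OF xc] by simp
  \<comment> \<open>If both exponents vanished, \<open>x\<close> and \<open>inv x\<close> would lie
    in the pointed cone \<open>P\<close>, against \<open>x \<noteq> \<one>\<close>.\<close>
  have "k + l > 0"
  proof (rule ccontr)
    assume "\<not> k + l > 0"
    then have "k = 0" "l = 0" by simp_all
    then have "p = x" "q = inv x" using pk(1) ql(1) pq by simp_all
    then show False using P pk(2) ql(2) x(3) by (simp add: pointed_cone_def)
  qed
  moreover have "inv (h [^] (k + l)) \<in> P"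
  proof -
    have "inv (h [^] (k + l)) = p \<otimes> q"
      using inv_equality[OF one] h pq by simp
    then show ?thesis using P.m_closed[OF pk(2) ql(2)] by simp
  qed
  ultimately show thesis by (rule that)
qed

text \<open>Zorn's lemma gives a maximal pointed cone \<open>P\<close>. If it contained neither
  \<open>g\<close> nor \<open>inv g\<close>, it would contain \<open>inv (g [^] k)\<close> and
  \<open>g [^] l\<close> with \<open>k, l > 0\<close>, hence both \<open>g [^] (l * k)\<close> and
  its inverse. Pointedness makes this power trivial, and torsion-freeness gives
  \<open>g = \<one>\<close>, which is in \<open>P\<close>.\<close>

lemma (in comm_group) total_pointed_cone:
  assumes "torsion_free G"
  obtains P where "pointed_cone P" "\<And>g. g \<in> carrier G \<Longrightarrow> g \<in> P \<or> inv g \<in> P"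
proof -
  have "\<exists>P\<in>Collect pointed_cone. \<forall>Q\<in>Collect pointed_cone. P \<subseteq> Q \<longrightarrow> Q = P"
  proof (rule subset_Zorn_nonempty)
    have "pointed_cone {\<one>}" unfolding pointed_cone_def by (simp add: submonoid_def)
    then show "Collect pointed_cone \<noteq> {}" by blast
  next
    fix C assume C: "C \<noteq> {}" "subset.chain (Collect pointed_cone) C"
    then have cone: "\<And>P. P \<in> C \<Longrightarrow> pointed_cone P" by (auto simp: subset_chain_def)
    then have sub: "\<And>P. P \<in> C \<Longrightarrow> submonoid P G" by (simp add: pointed_cone_def)
    \<comment> \<open>Product closure and pointedness concern two elements at a time, so in a chain
      they can be checked inside a single member.\<close>
    have common: "\<exists>P\<in>C. x \<in> P \<and> y \<in> P" if "x \<in> \<Union>C" "y \<in> \<Union>C" for x y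
    proof -
      obtain P Q where PQ: "P \<in> C" "x \<in> P" "Q \<in> C" "y \<in> Q" using \<open>x \<in> \<Union>C\<close> \<open>y \<in> \<Union>C\<close> by auto
      then have "P \<subseteq> Q \<or> Q \<subseteq> P" using C(2) by (auto simp: subset_chain_def)
      then show ?thesis using PQ by blast
    qed
    have "submonoid (\<Union>C) G"
    proof
      show "\<Union>C \<subseteq> carrier G" using submonoid.subset[OF sub] by blast
      show "\<one> \<in> \<Union>C" using submonoid.one_closed[OF sub] C(1) by blast
      show "x \<otimes> y \<in> \<Union>C" if "x \<in> \<Union>C" "y \<in> \<Union>C" for x y
        using common[OF that] submonoid.m_closed[OF sub] by blast
    qed
    moreover have "x = \<one>" if "x \<in> \<Union>C" "inv x \<in> \<Union>C" for x
      using common[OF that] cone by (auto simp: pointed_cone_def)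
    ultimately show "\<Union>C \<in> Collect pointed_cone" by (auto simp: pointed_cone_def)
  qed
  then obtain P where P: "pointed_cone P" and max: "\<And>Q. \<lbrakk>pointed_cone Q; P \<subseteq> Q\<rbrakk> \<Longrightarrow> Q = P"
    by auto
  interpret P: submonoid P G using P by (simp add: pointed_cone_def)
  have pow: "p [^] k \<in> P" if "p \<in> P" for p and k :: nat
    using that by (induction k) (auto simp: P.m_closed P.one_closed)
  have "g \<in> P \<or> inv g \<in> P" if g: "g \<in> carrier G" for g
  proof (rule ccontr)
    assume *: "\<not> (g \<in> P \<or> inv g \<in> P)"
    obtain k :: nat where k: "k > 0" "inv (g [^] k) \<in> P"
      using maximal_pointed_cone_power[OF P max g] * by auto
    obtain l :: nat where l: "l > 0" "inv ((inv g) [^] l) \<in> P"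
      using maximal_pointed_cone_power[OF P max inv_closed[OF g]] * by auto
    have "inv ((inv g) [^] l) = g [^] l" using g by (simp add: nat_pow_inv)
    then have "g [^] (l * k) \<in> P" using pow[OF l(2), of k] g by (simp add: nat_pow_pow)
    moreover have "inv (g [^] (l * k)) = (inv (g [^] k)) [^] l"
      using g by (simp add: nat_pow_inv nat_pow_pow mult.commute)
    then have "inv (g [^] (l * k)) \<in> P" using pow[OF k(2), of l] by simp
    ultimately have "g [^] (l * k) = \<one>" using P by (simp add: pointed_cone_def)
    moreover have "l * k > 0" using k(1) l(1) by simp
    ultimately have "g = \<one>" using assms g unfolding torsion_free_def by blast
    then show False using * P.one_closed by simp
  qed
  then show thesis using that[OF P] by simp
qed

text \<open>Levi's theorem. With a total pointed cone as the set of elements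
  \<open>\<ge> \<one>\<close>, product closure gives transitivity, pointedness gives antisymmetry,
  and totality of the cone gives totality of the order.\<close>

lemma (in comm_group) torsion_free_imp_translation_order:
  assumes "torsion_free G"
  obtains lt where "translation_order G lt"
proof -
  obtain P where P: "pointed_cone P" and tot: "\<And>g. g \<in> carrier G \<Longrightarrow> g \<in> P \<or> inv g \<in> P"
    using total_pointed_cone[OF assms] by blast
  interpret P: submonoid P G using P by (simp add: pointed_cone_def)
  define lt where "lt x y \<longleftrightarrow> x \<noteq> y \<and> inv x \<otimes> y \<in> P" for x y
  have inv: "inv (inv x \<otimes> y) = inv y \<otimes> x" if "x \<in> carrier G" "y \<in> carrier G" for x y
    using that by (simp add: inv_mult m_comm)
  have anti: "x = y" if "inv x \<otimes> y \<in> P" "inv y \<otimes> x \<in> P" and c: "x \<in> carrier G" "y \<in> carrier G" for x y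
  proof -
    have "inv x \<otimes> y = \<one>" using P that inv[OF c] by (simp add: pointed_cone_def)
    then have "inv (inv y) = inv (inv x)" using inv_equality[of "inv x" y] c by simp
    then show ?thesis using c by simp
  qed
  have "asymp_on (carrier G) lt"
    using anti by (auto simp: asymp_on_def lt_def)
  moreover have "transp_on (carrier G) lt"
  proof (rule transp_onI)
    fix x y z assume c: "x \<in> carrier G" "y \<in> carrier G" "z \<in> carrier G" and "lt x y" "lt y z"
    then have xy: "inv x \<otimes> y \<in> P" "x \<noteq> y" and yz: "inv y \<otimes> z \<in> P" by (simp_all add: lt_def)
    have "(inv x \<otimes> y) \<otimes> (inv y \<otimes> z) = inv x \<otimes> ((y \<otimes> inv y) \<otimes> z)"
      using c by (simp only: m_assoc m_closed inv_closed)
    then have "inv x \<otimes> z \<in> P" using P.m_closed[OF xy(1) yz] c by simp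
    moreover have "x \<noteq> z" using anti[OF xy(1)] xy(2) yz c by auto
    ultimately show "lt x z" by (simp add: lt_def)
  qed
  moreover have "totalp_on (carrier G) lt"
  proof (rule totalp_onI)
    fix x y assume c: "x \<in> carrier G" "y \<in> carrier G" and "x \<noteq> y"
    then show "lt x y \<or> lt y x" using tot[of "inv x \<otimes> y"] inv[OF c] by (auto simp: lt_def)
  qed
  moreover have "lt (z \<otimes> x) (z \<otimes> y)"
    if c: "x \<in> carrier G" "y \<in> carrier G" "z \<in> carrier G" and "lt x y" for x y z
  proof -
    have "inv (z \<otimes> x) \<otimes> (z \<otimes> y) = inv x \<otimes> ((inv z \<otimes> z) \<otimes> y)"
      using c by (simp only: inv_mult_group m_assoc m_closed inv_closed)
    then have "inv (z \<otimes> x) \<otimes> (z \<otimes> y) = inv x \<otimes> y" using c by simp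
    then show ?thesis using that by (simp add: lt_def)
  qed
  ultimately have "translation_order G lt" by (simp add: translation_order_def)
  then show thesis by (rule that)
qed

section \<open>Maximal ideals and the Jacobson radical\<close>

text \<open>Zorn's lemma for the ideals that contain \<open>I\<close> and avoid
  \<open>\<one>\<close>: a union of such ideals still avoids \<open>\<one>\<close>, and an ideal
  containing \<open>\<one>\<close> is the whole ring.\<close>

lemma (in ring) proper_ideal_imp_maximalideal:
  assumes I: "ideal I R" "\<one> \<notin> I"
  obtains M where "maximalideal M R" "I \<subseteq> M"
proof -
  define S where "S = {J. ideal J R \<and> I \<subseteq> J \<and> \<one> \<notin> J}"
  have "\<exists>M\<in>S. \<forall>J\<in>S. M \<subseteq> J \<longrightarrow> J = M"
  proof (rule subset_Zorn_nonempty)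
    show "S \<noteq> {}" using I by (auto simp: S_def)
  next
    fix C assume C: "C \<noteq> {}" "subset.chain S C"
    then have "subset.chain {I. ideal I R} C" by (auto simp: subset_chain_def S_def)
    then have "ideal (\<Union>C) R" using chain_Union_is_ideal[of C] C(1) by simp
    then show "\<Union>C \<in> S" using C by (auto simp: S_def subset_chain_def)
  qed
  then obtain M where M: "M \<in> S" and max: "\<And>J. \<lbrakk>J \<in> S; M \<subseteq> J\<rbrakk> \<Longrightarrow> J = M" by blast
  have "maximalideal M R"
  proof (rule maximalidealI)
    show "ideal M R" using M by (simp add: S_def)
    show "carrier R \<noteq> M" using M by (auto simp: S_def)
    fix J assume J: "ideal J R" "M \<subseteq> J" "J \<subseteq> carrier R"
    show "J = M \<or> J = carrier R"
    proof (cases "\<one> \<in> J")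
      case True
      then show ?thesis using ideal.one_imp_carrier[OF J(1)] by blast
    next
      case False
      then show ?thesis using max[of J] J M by (auto simp: S_def)
    qed
  qed
  then show thesis using that M by (auto simp: S_def)
qed

lemma (in cring) ideal_jacobson_radical: "ideal jacobson_radical R"
proof -
  \<comment> \<open>Inserting the carrier keeps the family nonempty in the zero ring, as
    \<open>i_Intersect\<close> requires.\<close>
  have "jacobson_radical = \<Inter>(insert (carrier R) {M. maximalideal M R})"
    by (simp add: jacobson_radical_def)
  also have "ideal \<dots> R"
    by (rule i_Intersect) (auto simp: oneideal intro: maximalideal.axioms(1))
  finally show ?thesis .
qed

text \<open>A non-unit \<open>\<one> \<oplus> x\<close> generates a proper ideal, which lies in some
  maximal ideal. That ideal also contains \<open>x\<close>, hence \<open>\<one>\<close>.\<close>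

lemma (in cring) one_plus_jacobson_radical_unit:
  assumes x: "x \<in> jacobson_radical"
  shows "\<exists>y\<in>carrier R. (\<one> \<oplus> x) \<otimes> y = \<one>"
proof (rule ccontr)
  assume no: "\<not> ?thesis"
  have xc: "x \<in> carrier R" using x by (simp add: jacobson_radical_def)
  let ?u = "\<one> \<oplus> x"
  have u: "?u \<in> carrier R" using xc by simp
  have "\<one> \<notin> PIdl ?u" using no u m_comm by (force simp: cgenideal_def)
  then obtain M where M: "maximalideal M R" "PIdl ?u \<subseteq> M"
    using proper_ideal_imp_maximalideal cgenideal_ideal[OF u] by blast
  interpret M: maximalideal M R by fact
  have "?u \<in> M" using M cgenideal_self[OF u] by blast
  moreover have "x \<in> M" using x M by (auto simp: jacobson_radical_def)
  ultimately have "?u \<ominus> x \<in> M" using M.a_closed M.a_inv_closed by (simp add: a_minus_def)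
  moreover have "?u \<ominus> x = \<one>" using xc by algebra
  ultimately show False using M.one_imp_carrier M.I_notcarr by simp
qed

section \<open>Finite sums and ideals\<close>

lemma (in ideal) finsum_mem:
  assumes "\<And>i. i \<in> F \<Longrightarrow> g i \<in> I"
  shows "finsum R g F \<in> I"
  using assms
proof (induction F rule: infinite_finite_induct)
  case (insert i F)
  then have "g \<in> F \<rightarrow> carrier R" "g i \<in> carrier R" using a_Hcarr by auto
  then show ?case using insert by (simp add: finsum_insert)
qed (auto simp: finsum_infinite)

text \<open>Subtract the other summands, whose sum lies in \<open>I\<close>. Applied below to
  convolution sums and to decompositions of radical elements.\<close>

lemma (in ideal) finsum_mem_imp_summand_mem:
  assumes "finite F" "a \<in> F" and g: "\<And>i. i \<in> F \<Longrightarrow> g i \<in> carrier R"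
    and rest: "\<And>i. \<lbrakk>i \<in> F; i \<noteq> a\<rbrakk> \<Longrightarrow> g i \<in> I"
    and sum: "finsum R g F \<in> I"
  shows "g a \<in> I"
proof -
  let ?s = "finsum R g (F - {a})"
  have s: "?s \<in> I" using rest by (intro finsum_mem) auto
  have "finsum R g (insert a (F - {a})) = g a \<oplus> ?s"
    using assms by (intro finsum_insert) auto
  then have "g a \<oplus> ?s \<in> I" using sum \<open>a \<in> F\<close> by (simp add: insert_absorb)
  then have "(g a \<oplus> ?s) \<ominus> ?s \<in> I" using s by (simp add: a_minus_def)
  moreover have "(g a \<oplus> ?s) \<ominus> ?s = g a"
    using g[OF \<open>a \<in> F\<close>] a_Hcarr[OF s] by algebra
  ultimately show ?thesis by simp
qed

section \<open>Homogeneous components\<close>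

context graded_ring
begin

text \<open>Determined by \<open>direct_sum\<close> for \<open>x\<close> in
  \<open>carrier R\<close>; at indices outside \<open>carrier G\<close> the value is then
  \<open>undefined\<close>, as the families are extensional.\<close>

definition components :: "'a \<Rightarrow> 'g \<Rightarrow> 'a" where
  "components x = (THE r. r \<in> component_families G R A \<and> x = family_sum G R r)"

definition grade_support :: "'a \<Rightarrow> 'g set" where
  "grade_support x = {n \<in> carrier G. components x n \<noteq> \<zero>\<^bsub>R\<^esub>}"

lemma homogeneous_carrier: "\<lbrakk>n \<in> carrier G; a \<in> A n\<rbrakk> \<Longrightarrow> a \<in> carrier R"
  using additive_subgroup.a_Hcarr[OF component_subgroup] .

lemma component_families_carrier:
  assumes "r \<in> component_families G R A" "n \<in> carrier G"
  shows "r n \<in> A n" "r n \<in> carrier R"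
  using assms homogeneous_carrier by (auto simp: component_families_def)

text \<open>The terms added outside the support vanish. This allows a common index set for several
  families.\<close>

lemma family_sum_eq_finsum:
  assumes r: "r \<in> component_families G R A" and F: "finite F" "F \<subseteq> carrier G"
    and zero: "\<And>n. \<lbrakk>n \<in> carrier G; n \<notin> F\<rbrakk> \<Longrightarrow> r n = \<zero>\<^bsub>R\<^esub>"
  shows "family_sum G R r = finsum R r F"
  unfolding family_sum_def
  using F zero component_families_carrier[OF r]
  by (intro R.add.finprod_mono_neutral_cong_left) auto

lemma family_sum_carrier:
  assumes "r \<in> component_families G R A"
  shows "family_sum G R r \<in> carrier R"
  unfolding family_sum_def using component_families_carrier[OF assms] by (intro R.finsum_closed) auto

lemma components_family_sum:
  assumes "r \<in> component_families G R A"
  shows "components (family_sum G R r) = r"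
  unfolding components_def
  by (rule the1_equality[OF direct_sum[OF family_sum_carrier[OF assms]]]) (simp add: assms)

text \<open>The decomposition is unique, so any expression of \<open>x\<close> as a finite sum of
  homogeneous elements of distinct degrees yields its components.\<close>

lemma components_eqI:
  assumes F: "finite F" "F \<subseteq> carrier G" and g: "\<And>n. n \<in> F \<Longrightarrow> g n \<in> A n"
    and x: "x = finsum R g F" and n: "n \<in> carrier G"
  shows "components x n = (if n \<in> F then g n else \<zero>\<^bsub>R\<^esub>)"
proof -
  \<comment> \<open>\<open>g\<close> extended by zero to all degrees, and made extensional by
    restriction to \<open>carrier G\<close>.\<close>
  define r where "r = (\<lambda>n\<in>carrier G. if n \<in> F then g n else \<zero>\<^bsub>R\<^esub>)"
  have "{n \<in> carrier G. r n \<noteq> \<zero>\<^bsub>R\<^esub>} \<subseteq> F" by (auto simp: r_def)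
  then have fin: "finite {n \<in> carrier G. r n \<noteq> \<zero>\<^bsub>R\<^esub>}" using F(1) finite_subset by blast
  have "r \<in> (\<Pi>\<^sub>E n\<in>carrier G. A n)"
    using g additive_subgroup.zero_closed[OF component_subgroup] by (auto simp: r_def)
  with fin have r: "r \<in> component_families G R A" by (simp add: component_families_def)
  have "family_sum G R r = finsum R r F"
    by (rule family_sum_eq_finsum[OF r F]) (simp add: r_def)
  also have "\<dots> = finsum R g F"
    using F g homogeneous_carrier by (intro R.finsum_cong') (auto simp: r_def)
  finally have "x = family_sum G R r" using x by simp
  then show ?thesis using components_family_sum[OF r] n by (simp add: r_def)
qed

lemma components_mem_families:
  assumes "x \<in> carrier R"
  shows "components x \<in> component_families G R A" "family_sum G R (components x) = x"
  using theI'[OF direct_sum[OF assms]] by (simp_all add: components_def)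

lemma component_homogeneous [simp]:
  assumes "x \<in> carrier R" "n \<in> carrier G"
  shows "components x n \<in> A n" "components x n \<in> carrier R"
  using component_families_carrier[OF components_mem_families(1)[OF assms(1)] assms(2)] .

lemma grade_support_subset: "grade_support x \<subseteq> carrier G"
  by (auto simp: grade_support_def)

lemma finite_grade_support: "x \<in> carrier R \<Longrightarrow> finite (grade_support x)"
  using components_mem_families(1) by (auto simp: grade_support_def component_families_def)

lemma finsum_components_superset:
  assumes x: "x \<in> carrier R" and "finite F" "F \<subseteq> carrier G" "grade_support x \<subseteq> F"
  shows "finsum R (components x) F = x"
proof -
  have "family_sum G R (components x) = finsum R (components x) F"
    using assms by (intro family_sum_eq_finsum components_mem_families(1)) (auto simp: grade_support_def)
  then show ?thesis using components_mem_families(2)[OF x] by simp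
qed

lemma finsum_components:
  assumes "x \<in> carrier R"
  shows "finsum R (components x) (grade_support x) = x"
  using assms by (intro finsum_components_superset) (simp_all add: finite_grade_support grade_support_subset)

lemma components_zero: "n \<in> carrier G \<Longrightarrow> components \<zero>\<^bsub>R\<^esub> n = \<zero>\<^bsub>R\<^esub>"
  using components_eqI[of "{}" undefined "\<zero>\<^bsub>R\<^esub>" n] by simp

lemma components_of_homogeneous:
  assumes "m \<in> carrier G" "a \<in> A m" "n \<in> carrier G"
  shows "components a n = (if n = m then a else \<zero>\<^bsub>R\<^esub>)"
  using components_eqI[of "{m}" "\<lambda>_. a" a n] assms homogeneous_carrier by simp

section \<open>Components of sums and products\<close>

lemma components_add:
  assumes x: "x \<in> carrier R" and y: "y \<in> carrier R" and n: "n \<in> carrier G"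
  shows "components (x \<oplus>\<^bsub>R\<^esub> y) n = components x n \<oplus>\<^bsub>R\<^esub> components y n"
proof -
  let ?F = "grade_support x \<union> grade_support y"
  have F: "finite ?F" "?F \<subseteq> carrier G"
    using x y by (simp_all add: finite_grade_support grade_support_subset)
  have mem: "n \<in> carrier G" if "n \<in> ?F" for n using F(2) that by blast
  have "finsum R (\<lambda>n. components x n \<oplus>\<^bsub>R\<^esub> components y n) ?F
      = finsum R (components x) ?F \<oplus>\<^bsub>R\<^esub> finsum R (components y) ?F"
    using x y mem by (intro R.finsum_addf) auto
  also have "\<dots> = x \<oplus>\<^bsub>R\<^esub> y"
    using x y F by (simp add: finsum_components_superset)
  finally have "components (x \<oplus>\<^bsub>R\<^esub> y) n
      = (if n \<in> ?F then components x n \<oplus>\<^bsub>R\<^esub> components y n else \<zero>\<^bsub>R\<^esub>)"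
    using x y n F mem
    by (intro components_eqI) (auto simp: additive_subgroup.a_closed[OF component_subgroup])
  then show ?thesis using n by (auto simp: grade_support_def)
qed

lemma components_finsum:
  assumes "\<And>i. i \<in> F \<Longrightarrow> g i \<in> carrier R" and n: "n \<in> carrier G"
  shows "components (finsum R g F) n = finsum R (\<lambda>i. components (g i) n) F"
  using assms(1)
proof (induction F rule: infinite_finite_induct)
  case (insert i F)
  then have g: "g \<in> F \<rightarrow> carrier R" "g i \<in> carrier R" by auto
  then have "(\<lambda>i. components (g i) n) \<in> F \<rightarrow> carrier R" using n by (auto simp: Pi_iff)
  then show ?case using insert g n by (simp add: R.finsum_insert components_add)
qed (use n in \<open>auto simp: R.finsum_infinite components_zero\<close>)

text \<open>Multiplication by \<open>a\<close> moves degree \<open>n\<close> to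
  \<open>m \<otimes> n\<close>, so the decomposition of \<open>x\<close>, multiplied by
  \<open>a\<close> and reindexed along this shift, decomposes the product.\<close>

lemma components_mult_homogeneous:
  assumes m: "m \<in> carrier G" and a: "a \<in> A m" and x: "x \<in> carrier R" and k: "k \<in> carrier G"
  shows "components (a \<otimes>\<^bsub>R\<^esub> x) k = a \<otimes>\<^bsub>R\<^esub> components x (inv\<^bsub>G\<^esub> m \<otimes>\<^bsub>G\<^esub> k)"
proof -
  let ?h = "\<lambda>n. m \<otimes>\<^bsub>G\<^esub> n"
  let ?F = "?h ` grade_support x"
  let ?g = "\<lambda>k. a \<otimes>\<^bsub>R\<^esub> components x (inv\<^bsub>G\<^esub> m \<otimes>\<^bsub>G\<^esub> k)"
  have ac: "a \<in> carrier R" using m a by (rule homogeneous_carrier)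
  have shift: "inv\<^bsub>G\<^esub> m \<otimes>\<^bsub>G\<^esub> (m \<otimes>\<^bsub>G\<^esub> n) = n" "m \<otimes>\<^bsub>G\<^esub> (inv\<^bsub>G\<^esub> m \<otimes>\<^bsub>G\<^esub> n) = n"
    if "n \<in> carrier G" for n
    using m that by (simp_all add: G.m_assoc[symmetric])
  have F: "finite ?F" "?F \<subseteq> carrier G"
    using x m grade_support_subset[of x] by (auto simp: finite_grade_support)
  have gA: "?g n \<in> A n" if "n \<in> carrier G" for n
    using component_mult[OF m _ a, of "inv\<^bsub>G\<^esub> m \<otimes>\<^bsub>G\<^esub> n"] m x that
    by (simp add: shift)
  have inj: "inj_on ?h (grade_support x)"
    using m grade_support_subset[of x] by (intro inj_onI) (metis G.l_cancel subsetD)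
  have "finsum R ?g ?F = finsum R (\<lambda>n. ?g (?h n)) (grade_support x)"
    using inj F ac m x grade_support_subset[of x] by (intro R.finsum_reindex) auto
  also have "\<dots> = finsum R (\<lambda>n. a \<otimes>\<^bsub>R\<^esub> components x n) (grade_support x)"
    using ac x shift(1) grade_support_subset[of x] by (intro R.finsum_cong') auto
  also have "\<dots> = a \<otimes>\<^bsub>R\<^esub> finsum R (components x) (grade_support x)"
    using ac x grade_support_subset[of x]
    by (intro R.finsum_rdistr[symmetric]) (auto simp: finite_grade_support)
  also have "\<dots> = a \<otimes>\<^bsub>R\<^esub> x" using x by (simp add: finsum_components)
  finally have "components (a \<otimes>\<^bsub>R\<^esub> x) k = (if k \<in> ?F then ?g k else \<zero>\<^bsub>R\<^esub>)"
    using F gA k by (intro components_eqI) auto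
  \<comment> \<open>Degrees outside the shifted support also obey the formula, both sides being zero
    there.\<close>
  moreover have "components x (inv\<^bsub>G\<^esub> m \<otimes>\<^bsub>G\<^esub> k) = \<zero>\<^bsub>R\<^esub>" if "k \<notin> ?F"
  proof (rule ccontr)
    assume "components x (inv\<^bsub>G\<^esub> m \<otimes>\<^bsub>G\<^esub> k) \<noteq> \<zero>\<^bsub>R\<^esub>"
    then have "inv\<^bsub>G\<^esub> m \<otimes>\<^bsub>G\<^esub> k \<in> grade_support x" using m k by (simp add: grade_support_def)
    then have "?h (inv\<^bsub>G\<^esub> m \<otimes>\<^bsub>G\<^esub> k) \<in> ?F" by (rule imageI)
    then show False using that k by (simp add: shift)
  qed
  ultimately show ?thesis using ac by simp
qed

text \<open>The convolution formula with only \<open>x\<close> expanded: the finite support of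
  \<open>x\<close> bounds the sum, and \<open>i\<close> determines the matching degree of
  \<open>y\<close>.\<close>

lemma components_mult:
  assumes x: "x \<in> carrier R" and y: "y \<in> carrier R" and k: "k \<in> carrier G"
  shows "components (x \<otimes>\<^bsub>R\<^esub> y) k
    = finsum R (\<lambda>i. components x i \<otimes>\<^bsub>R\<^esub> components y (inv\<^bsub>G\<^esub> i \<otimes>\<^bsub>G\<^esub> k)) (grade_support x)"
proof -
  have mem: "i \<in> carrier G" if "i \<in> grade_support x" for i using that grade_support_subset by blast
  have "x \<otimes>\<^bsub>R\<^esub> y = finsum R (components x) (grade_support x) \<otimes>\<^bsub>R\<^esub> y"
    using x by (simp add: finsum_components)
  also have "\<dots> = finsum R (\<lambda>i. components x i \<otimes>\<^bsub>R\<^esub> y) (grade_support x)"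
    using x y mem by (intro R.finsum_ldistr) (auto simp: finite_grade_support)
  finally have "components (x \<otimes>\<^bsub>R\<^esub> y) k
      = finsum R (\<lambda>i. components (components x i \<otimes>\<^bsub>R\<^esub> y) k) (grade_support x)"
    using x y k mem by (simp add: components_finsum)
  also have "\<dots> = finsum R (\<lambda>i. components x i \<otimes>\<^bsub>R\<^esub> components y (inv\<^bsub>G\<^esub> i \<otimes>\<^bsub>G\<^esub> k)) (grade_support x)"
    using x y k mem by (intro R.finsum_cong') (auto simp: components_mult_homogeneous)
  finally show ?thesis .
qed

text \<open>Let \<open>?e\<close> be the component of the ring identity in the identity degree.
  Comparing components of degree \<open>m\<close> in \<open>a \<otimes> \<one> = a\<close> gives
  \<open>a \<otimes> ?e = a\<close> for \<open>a\<close> of degree \<open>m\<close>. Summing this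
  over the components of \<open>\<one>\<close> gives \<open>?e = \<one>\<close>.\<close>

lemma one_homogeneous: "\<one>\<^bsub>R\<^esub> \<in> A \<one>\<^bsub>G\<^esub>"
proof -
  let ?e = "components \<one>\<^bsub>R\<^esub> \<one>\<^bsub>G\<^esub>"
  have mem: "i \<in> carrier G" if "i \<in> grade_support x" for i x using that grade_support_subset by blast
  have e: "a \<otimes>\<^bsub>R\<^esub> ?e = a" if "m \<in> carrier G" "a \<in> A m" for a m
    using components_mult_homogeneous[OF that R.one_closed that(1)]
      components_of_homogeneous[OF that that(1)] homogeneous_carrier[OF that] that(1) by simp
  have "?e = finsum R (components \<one>\<^bsub>R\<^esub>) (grade_support \<one>\<^bsub>R\<^esub>) \<otimes>\<^bsub>R\<^esub> ?e"
    by (simp add: finsum_components)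
  also have "\<dots> = finsum R (\<lambda>i. components \<one>\<^bsub>R\<^esub> i \<otimes>\<^bsub>R\<^esub> ?e) (grade_support \<one>\<^bsub>R\<^esub>)"
    using mem by (intro R.finsum_ldistr) (auto simp: finite_grade_support)
  also have "\<dots> = finsum R (components \<one>\<^bsub>R\<^esub>) (grade_support \<one>\<^bsub>R\<^esub>)"
    using mem by (intro R.finsum_cong') (auto intro!: e[OF _ component_homogeneous(1)])
  also have "\<dots> = \<one>\<^bsub>R\<^esub>" by (simp add: finsum_components)
  finally show ?thesis using component_homogeneous(1)[of "\<one>\<^bsub>R\<^esub>" "\<one>\<^bsub>G\<^esub>"] by simp
qed

lemma components_one:
  "n \<in> carrier G \<Longrightarrow> components \<one>\<^bsub>R\<^esub> n = (if n = \<one>\<^bsub>G\<^esub> then \<one>\<^bsub>R\<^esub> else \<zero>\<^bsub>R\<^esub>)"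
  using components_of_homogeneous[OF G.one_closed one_homogeneous] .

subsection \<open>Components of units\<close>

text \<open>In the convolution sum for degree \<open>a \<otimes> b\<close> every summand except the
  one at \<open>a\<close> lies in \<open>M\<close>. Used contrapositively for prime
  \<open>M\<close>: if neither factor is in \<open>M\<close>, neither is this component of the
  product.\<close>

lemma product_component_mem_ideal:
  assumes M: "ideal M R" and x: "x \<in> carrier R" and y: "y \<in> carrier R"
    and a: "a \<in> carrier G" and b: "b \<in> carrier G"
    and rest: "\<And>i. \<lbrakk>i \<in> carrier G; i \<noteq> a\<rbrakk> \<Longrightarrow>
      components x i \<in> M \<or> components y (inv\<^bsub>G\<^esub> i \<otimes>\<^bsub>G\<^esub> (a \<otimes>\<^bsub>G\<^esub> b)) \<in> M"
    and mem: "components (x \<otimes>\<^bsub>R\<^esub> y) (a \<otimes>\<^bsub>G\<^esub> b) \<in> M"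
  shows "components x a \<otimes>\<^bsub>R\<^esub> components y b \<in> M"
proof (cases "a \<in> grade_support x")
  \<comment> \<open>Here the convolution sum has no term at \<open>a\<close>, and the product in
    question is zero.\<close>
  case False
  then show ?thesis
    using y a b additive_subgroup.zero_closed[OF ideal.axioms(1)[OF M]]
    by (simp add: grade_support_def)
next
  case True
  interpret M: ideal M R by fact
  let ?g = "\<lambda>i. components x i \<otimes>\<^bsub>R\<^esub> components y (inv\<^bsub>G\<^esub> i \<otimes>\<^bsub>G\<^esub> (a \<otimes>\<^bsub>G\<^esub> b))"
  have sub: "i \<in> carrier G" if "i \<in> grade_support x" for i
    using that grade_support_subset by blast
  have "?g a \<in> M"
  proof (rule M.finsum_mem_imp_summand_mem[where F = "grade_support x" and g = ?g])
    show "finite (grade_support x)" using x by (rule finite_grade_support)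
    show "a \<in> grade_support x" by (rule True)
    show "?g i \<in> carrier R" if "i \<in> grade_support x" for i
      using sub[OF that] x y a b by simp
    show "?g i \<in> M" if "i \<in> grade_support x" "i \<noteq> a" for i
      using rest[OF sub[OF that(1)] that(2)] M.I_l_closed M.I_r_closed sub[OF that(1)] x y a b
      by auto
    show "finsum R ?g (grade_support x) \<in> M"
      using mem x y a b by (simp add: components_mult)
  qed
  moreover have "inv\<^bsub>G\<^esub> a \<otimes>\<^bsub>G\<^esub> (a \<otimes>\<^bsub>G\<^esub> b) = b"
    using a b by (simp add: G.m_assoc[symmetric])
  ultimately show ?thesis by simp
qed

lemma exists_component_notin_ideal:
  assumes M: "ideal M R" and x: "x \<in> carrier R" "x \<notin> M"
  shows "\<exists>n\<in>carrier G. components x n \<notin> M"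
  using ideal.finsum_mem[OF M, of "grade_support x" "components x"] x grade_support_subset
  by (auto simp: finsum_components)

text \<open>Take \<open>a\<close> and \<open>b\<close> greatest among the degrees of components
  outside \<open>M\<close>. If \<open>i \<otimes> j = a \<otimes> b\<close> with
  \<open>i \<noteq> a\<close> and both components outside \<open>M\<close>, then \<open>i\<close> is
  below \<open>a\<close> and \<open>j\<close> is at most \<open>b\<close>, against invariance. So
  the component of the product in degree \<open>a \<otimes> b\<close> is outside \<open>M\<close>,
  in particular nonzero, and \<open>\<one>\<close> is nonzero only in the identity degree.\<close>

lemma unit_extremal_components:
  assumes lt: "translation_order G lt" and M: "primeideal M R"
    and x: "x \<in> carrier R" and y: "y \<in> carrier R" and xy: "x \<otimes>\<^bsub>R\<^esub> y = \<one>\<^bsub>R\<^esub>"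
  obtains a b where "a \<in> carrier G" "components x a \<notin> M" "b \<in> carrier G" "components y b \<notin> M"
    "\<And>i. \<lbrakk>i \<in> carrier G; components x i \<notin> M; i \<noteq> a\<rbrakk> \<Longrightarrow> lt i a"
    "\<And>i. \<lbrakk>i \<in> carrier G; components y i \<notin> M; i \<noteq> b\<rbrakk> \<Longrightarrow> lt i b"
    "a \<otimes>\<^bsub>G\<^esub> b = \<one>\<^bsub>G\<^esub>"
proof -
  interpret M: primeideal M R by fact
  have greatest: "\<exists>a\<in>carrier G. components z a \<notin> M \<and>
      (\<forall>i\<in>carrier G. components z i \<notin> M \<longrightarrow> i \<noteq> a \<longrightarrow> lt i a)"
    if z: "z \<in> carrier R" "z \<notin> M" for z
  proof -
    let ?U = "{n \<in> carrier G. components z n \<notin> M}"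
    \<comment> \<open>Zero lies in \<open>M\<close>, so components outside \<open>M\<close> are
      nonzero and their degrees lie in the finite support.\<close>
    have "?U \<subseteq> grade_support z" by (auto simp: grade_support_def)
    then have fin: "finite ?U" using finite_grade_support[OF z(1)] finite_subset by blast
    have ne: "?U \<noteq> {}" using exists_component_notin_ideal[OF M.is_ideal z] by blast
    have "?U \<subseteq> carrier G" by blast
    then have "transp_on ?U lt" "totalp_on ?U lt"
      using lt transp_on_subset totalp_on_subset unfolding translation_order_def by blast+
    from Finite_Set.bex_greatest_element[OF fin ne this] show ?thesis by blast
  qed
  have one: "\<one>\<^bsub>R\<^esub> \<notin> M" using M.one_imp_carrier M.I_notcarr by blast
  have "x \<notin> M" "y \<notin> M" using one xy x y M.I_l_closed M.I_r_closed by metis+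
  then obtain a b where a: "a \<in> carrier G" "components x a \<notin> M"
    and amax: "\<And>i. \<lbrakk>i \<in> carrier G; components x i \<notin> M; i \<noteq> a\<rbrakk> \<Longrightarrow> lt i a"
    and b: "b \<in> carrier G" "components y b \<notin> M"
    and bmax: "\<And>i. \<lbrakk>i \<in> carrier G; components y i \<notin> M; i \<noteq> b\<rbrakk> \<Longrightarrow> lt i b"
    using greatest[OF x] greatest[OF y] by auto
  have "components x i \<in> M \<or> components y (inv\<^bsub>G\<^esub> i \<otimes>\<^bsub>G\<^esub> (a \<otimes>\<^bsub>G\<^esub> b)) \<in> M"
    if i: "i \<in> carrier G" "i \<noteq> a" for i
  proof (rule ccontr)
    let ?j = "inv\<^bsub>G\<^esub> i \<otimes>\<^bsub>G\<^esub> (a \<otimes>\<^bsub>G\<^esub> b)"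
    assume "\<not> ?thesis"
    then have ia: "lt i a" and j: "components y ?j \<notin> M" using amax i by auto
    have jc: "?j \<in> carrier G" using a b i by simp
    have ij: "i \<otimes>\<^bsub>G\<^esub> ?j = a \<otimes>\<^bsub>G\<^esub> b" using a b i by (simp add: G.m_assoc[symmetric])
    have "lt (b \<otimes>\<^bsub>G\<^esub> i) (b \<otimes>\<^bsub>G\<^esub> a)"
      using lt ia a b i by (simp add: translation_order_def)
    \<comment> \<open>This excludes both \<open>?j = b\<close> and \<open>lt ?j b\<close>, although
      \<open>b\<close> is greatest.\<close>
    then have 1: "lt (i \<otimes>\<^bsub>G\<^esub> b) (i \<otimes>\<^bsub>G\<^esub> ?j)"
      unfolding ij using a b i by (simp add: G.m_comm)
    have as: "asymp_on (carrier G) lt" using lt by (simp add: translation_order_def)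
    have "?j \<noteq> b"
    proof
      assume "?j = b"
      then show False using 1 asymp_onD[OF as, of "i \<otimes>\<^bsub>G\<^esub> b" "i \<otimes>\<^bsub>G\<^esub> b"] b i by simp
    qed
    then have "lt ?j b" using bmax[OF jc j] by simp
    then have "lt (i \<otimes>\<^bsub>G\<^esub> ?j) (i \<otimes>\<^bsub>G\<^esub> b)"
      using lt jc b i unfolding translation_order_def by blast
    then show False using 1 asymp_onD[OF as] b i jc by blast
  qed
  then have "components (x \<otimes>\<^bsub>R\<^esub> y) (a \<otimes>\<^bsub>G\<^esub> b) \<notin> M"
    using product_component_mem_ideal[OF M.is_ideal x y a(1) b(1)] a b x y
      M.I_prime[of "components x a" "components y b"] by auto
  then have "a \<otimes>\<^bsub>G\<^esub> b = \<one>\<^bsub>G\<^esub>"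
    using xy a b components_one[of "a \<otimes>\<^bsub>G\<^esub> b"] by (auto split: if_splits)
  then show thesis using that a amax b bmax by blast
qed

text \<open>Let \<open>a\<close> and \<open>c\<close> be the greatest and the least degree of a
  component of \<open>x\<close> outside \<open>M\<close>, with partners \<open>b\<close> and
  \<open>d\<close> for \<open>y\<close>. If \<open>c\<close> were below \<open>a\<close>, then
  \<open>\<one> = c \<otimes> d\<close> would be below \<open>a \<otimes> d\<close>, which is at
  most \<open>a \<otimes> b = \<one>\<close> because \<open>b\<close> is greatest for
  \<open>y\<close>.\<close>

lemma unit_component_unique:
  assumes tf: "torsion_free G" and M: "primeideal M R"
    and x: "x \<in> carrier R" and y: "y \<in> carrier R" and xy: "x \<otimes>\<^bsub>R\<^esub> y = \<one>\<^bsub>R\<^esub>"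
    and m: "m \<in> carrier G" "components x m \<notin> M" and n: "n \<in> carrier G" "components x n \<notin> M"
  shows "m = n"
proof -
  obtain lt where lt: "translation_order G lt" using G.torsion_free_imp_translation_order[OF tf] .
  have asym: "\<not> (lt u v \<and> lt v u)" if "u \<in> carrier G" "v \<in> carrier G" for u v
    using lt that by (auto simp: translation_order_def asymp_on_def)
  have trans: "lt u w" if "lt u v" "lt v w" "u \<in> carrier G" "v \<in> carrier G" "w \<in> carrier G" for u v w
    using lt that unfolding translation_order_def transp_on_def by blast
  have mono: "lt (w \<otimes>\<^bsub>G\<^esub> u) (w \<otimes>\<^bsub>G\<^esub> v)"
    if "lt u v" "u \<in> carrier G" "v \<in> carrier G" "w \<in> carrier G" for u v w
    using lt that by (simp add: translation_order_def)
  obtain a b where a: "a \<in> carrier G" "components x a \<notin> M" and b: "b \<in> carrier G"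
    and amax: "\<And>i. \<lbrakk>i \<in> carrier G; components x i \<notin> M; i \<noteq> a\<rbrakk> \<Longrightarrow> lt i a"
    and bmax: "\<And>i. \<lbrakk>i \<in> carrier G; components y i \<notin> M; i \<noteq> b\<rbrakk> \<Longrightarrow> lt i b"
    and ab: "a \<otimes>\<^bsub>G\<^esub> b = \<one>\<^bsub>G\<^esub>"
    using unit_extremal_components[OF lt M x y xy] by metis
  obtain c d where c: "c \<in> carrier G" "components x c \<notin> M" and d: "d \<in> carrier G" "components y d \<notin> M"
    and cmin: "\<And>i. \<lbrakk>i \<in> carrier G; components x i \<notin> M; i \<noteq> c\<rbrakk> \<Longrightarrow> lt c i"
    and cd: "c \<otimes>\<^bsub>G\<^esub> d = \<one>\<^bsub>G\<^esub>"
    using unit_extremal_components[OF translation_order_converse[OF lt] M x y xy]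
    unfolding conversep_iff by metis
  have "c = a"
  proof (rule ccontr)
    assume "c \<noteq> a"
    then have "lt c a" using amax c by simp
    then have "lt (d \<otimes>\<^bsub>G\<^esub> c) (d \<otimes>\<^bsub>G\<^esub> a)" using mono a c d by simp
    then have 1: "lt \<one>\<^bsub>G\<^esub> (a \<otimes>\<^bsub>G\<^esub> d)" using a c d cd by (simp add: G.m_comm)
    have "lt \<one>\<^bsub>G\<^esub> \<one>\<^bsub>G\<^esub>"
    proof (cases "d = b")
      case True
      then show ?thesis using 1 ab by simp
    next
      case False
      then have "lt (a \<otimes>\<^bsub>G\<^esub> d) (a \<otimes>\<^bsub>G\<^esub> b)" using mono bmax a b d by simp
      then show ?thesis using trans[OF 1] ab a d by simp
    qed
    then show False using asym by blast
  qed
  then have only: "i = a" if "i \<in> carrier G" "components x i \<notin> M" for i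
    using amax[OF that] cmin[OF that] asym[OF that(1) a(1)] by blast
  show ?thesis using only[OF m] only[OF n] by simp
qed

end

section \<open>Homogeneity of the Jacobson radical\<close>

locale graded_cring = graded_ring G R A + R: cring R
  for G :: "('g, 'm) monoid_scheme" and R :: "('a, 'r) ring_scheme" and A :: "'g \<Rightarrow> 'a set"
begin

text \<open>\<open>h \<otimes> f\<close> stays in the radical, so adding \<open>\<one>\<close> gives
  a unit. The free factor \<open>h\<close> serves to move components of \<open>f\<close> to chosen
  degrees.\<close>

lemma jacobson_radical_unit_component_unique:
  assumes tf: "torsion_free G" and M: "maximalideal M R"
    and f: "f \<in> R.jacobson_radical" and h: "h \<in> carrier R"
    and m: "m \<in> carrier G" "components (\<one>\<^bsub>R\<^esub> \<oplus>\<^bsub>R\<^esub> h \<otimes>\<^bsub>R\<^esub> f) m \<notin> M"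
    and n: "n \<in> carrier G" "components (\<one>\<^bsub>R\<^esub> \<oplus>\<^bsub>R\<^esub> h \<otimes>\<^bsub>R\<^esub> f) n \<notin> M"
  shows "m = n"
proof -
  have fc: "f \<in> carrier R" using f by (simp add: R.jacobson_radical_def)
  have "h \<otimes>\<^bsub>R\<^esub> f \<in> R.jacobson_radical"
    using ideal.I_l_closed[OF R.ideal_jacobson_radical f h] .
  then obtain y where "y \<in> carrier R" "(\<one>\<^bsub>R\<^esub> \<oplus>\<^bsub>R\<^esub> h \<otimes>\<^bsub>R\<^esub> f) \<otimes>\<^bsub>R\<^esub> y = \<one>\<^bsub>R\<^esub>"
    using R.one_plus_jacobson_radical_unit by blast
  then show ?thesis
    using unit_component_unique[OF tf R.maximalideal_prime[OF M] _ _ _ m n] fc h by simp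
qed

lemma components_one_plus_mult:
  assumes "k \<in> carrier G" "h \<in> A k" "f \<in> carrier R" "n \<in> carrier G"
  shows "components (\<one>\<^bsub>R\<^esub> \<oplus>\<^bsub>R\<^esub> h \<otimes>\<^bsub>R\<^esub> f) n =
    (if n = \<one>\<^bsub>G\<^esub> then \<one>\<^bsub>R\<^esub> else \<zero>\<^bsub>R\<^esub>) \<oplus>\<^bsub>R\<^esub> h \<otimes>\<^bsub>R\<^esub> components f (inv\<^bsub>G\<^esub> k \<otimes>\<^bsub>G\<^esub> n)"
  using assms homogeneous_carrier[OF assms(1,2)]
  by (simp add: components_add components_one components_mult_homogeneous)

lemma jacobson_radical_component_mem_maximalideal:
  assumes tf: "torsion_free G" and f: "f \<in> R.jacobson_radical"
    and n: "n \<in> carrier G" "n \<noteq> \<one>\<^bsub>G\<^esub>" and M: "maximalideal M R"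
  shows "components f n \<in> M"
proof (rule ccontr)
  let ?s = "components f n" and ?t = "components f (inv\<^bsub>G\<^esub> n)"
  assume s: "?s \<notin> M"
  interpret M: primeideal M R using R.maximalideal_prime[OF M] .
  have fc: "f \<in> carrier R" using f by (simp add: R.jacobson_radical_def)
  have c: "?s \<in> carrier R" "?t \<in> carrier R" using fc n by simp_all
  have one: "\<one>\<^bsub>R\<^esub> \<notin> M" using M.one_imp_carrier M.I_notcarr by blast
  have tor: "n [^]\<^bsub>G\<^esub> k \<noteq> \<one>\<^bsub>G\<^esub>" if "k > 0" for k :: nat
    using tf n that unfolding torsion_free_def by blast
  \<comment> \<open>Torsion-freeness keeps the summand \<open>\<one>\<close> of the units below out
    of these two degrees; \<open>nn\<close> also separates the two degrees compared for each
    unit.\<close>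
  have nn: "n \<otimes>\<^bsub>G\<^esub> n \<noteq> \<one>\<^bsub>G\<^esub>" using tor[of 2] n by (simp add: numeral_2_eq_2)
  have nnn: "n \<otimes>\<^bsub>G\<^esub> n \<otimes>\<^bsub>G\<^esub> n \<noteq> \<one>\<^bsub>G\<^esub>" using tor[of 3] n by (simp add: numeral_3_eq_3)
  have ss: "?s \<otimes>\<^bsub>R\<^esub> ?s \<notin> M" using M.I_prime[OF c(1) c(1)] s by blast
  have sss: "?s \<otimes>\<^bsub>R\<^esub> ?s \<otimes>\<^bsub>R\<^esub> ?s \<notin> M"
    using M.I_prime[OF _ c(1), of "?s \<otimes>\<^bsub>R\<^esub> ?s"] c s ss by blast
  have sA: "?s \<in> A n" using fc n by simp
  have ssA: "?s \<otimes>\<^bsub>R\<^esub> ?s \<in> A (n \<otimes>\<^bsub>G\<^esub> n)" using component_mult[OF n(1) n(1) sA sA] .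

  have shift: "inv\<^bsub>G\<^esub> (n \<otimes>\<^bsub>G\<^esub> n) \<otimes>\<^bsub>G\<^esub> n = inv\<^bsub>G\<^esub> n"
    "inv\<^bsub>G\<^esub> (n \<otimes>\<^bsub>G\<^esub> n) \<otimes>\<^bsub>G\<^esub> (n \<otimes>\<^bsub>G\<^esub> n \<otimes>\<^bsub>G\<^esub> n) = n"
    "inv\<^bsub>G\<^esub> n \<otimes>\<^bsub>G\<^esub> (n \<otimes>\<^bsub>G\<^esub> n) = n"
    using n by (simp_all add: G.inv_mult_group G.m_assoc)
      (simp_all add: G.m_assoc[symmetric])

  \<comment> \<open>First unit: its component in degree \<open>n \<otimes> n\<close> is outside
    \<open>M\<close>, which forces the one in the identity degree into \<open>M\<close>.\<close>
  let ?u = "\<one>\<^bsub>R\<^esub> \<oplus>\<^bsub>R\<^esub> ?s \<otimes>\<^bsub>R\<^esub> f"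
  have "components ?u (n \<otimes>\<^bsub>G\<^esub> n) = ?s \<otimes>\<^bsub>R\<^esub> ?s"
    using components_one_plus_mult[OF n(1) sA fc, of "n \<otimes>\<^bsub>G\<^esub> n"] n nn c shift by simp
  moreover have u1: "components ?u \<one>\<^bsub>G\<^esub> = \<one>\<^bsub>R\<^esub> \<oplus>\<^bsub>R\<^esub> ?s \<otimes>\<^bsub>R\<^esub> ?t"
    using components_one_plus_mult[OF n(1) sA fc, of "\<one>\<^bsub>G\<^esub>"] n by simp
  ultimately have inM: "\<one>\<^bsub>R\<^esub> \<oplus>\<^bsub>R\<^esub> ?s \<otimes>\<^bsub>R\<^esub> ?t \<in> M"
    using jacobson_radical_unit_component_unique[OF tf M f c(1), of "n \<otimes>\<^bsub>G\<^esub> n" "\<one>\<^bsub>G\<^esub>"] nn ss n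
    by auto
  have "?t \<notin> M"
  proof
    assume "?t \<in> M"
    then have st: "?s \<otimes>\<^bsub>R\<^esub> ?t \<in> M" using M.I_l_closed c by blast
    then have "(\<one>\<^bsub>R\<^esub> \<oplus>\<^bsub>R\<^esub> ?s \<otimes>\<^bsub>R\<^esub> ?t) \<ominus>\<^bsub>R\<^esub> (?s \<otimes>\<^bsub>R\<^esub> ?t) \<in> M"
      using inM by (simp add: a_minus_def)
    moreover have "(\<one>\<^bsub>R\<^esub> \<oplus>\<^bsub>R\<^esub> ?s \<otimes>\<^bsub>R\<^esub> ?t) \<ominus>\<^bsub>R\<^esub> (?s \<otimes>\<^bsub>R\<^esub> ?t) = \<one>\<^bsub>R\<^esub>"
      using c by (simp add: a_minus_def R.a_assoc R.r_neg)
    ultimately show False using one by simp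
  qed
  then have sst: "?s \<otimes>\<^bsub>R\<^esub> ?s \<otimes>\<^bsub>R\<^esub> ?t \<notin> M"
    using M.I_prime[OF _ c(2), of "?s \<otimes>\<^bsub>R\<^esub> ?s"] c ss by blast

  \<comment> \<open>Second unit: the factor of degree \<open>n \<otimes> n\<close> moves
    \<open>?s\<close> to degree \<open>n \<otimes> n \<otimes> n\<close> and \<open>?t\<close> to
    degree \<open>n\<close>, so two components lie outside \<open>M\<close>.\<close>
  let ?v = "\<one>\<^bsub>R\<^esub> \<oplus>\<^bsub>R\<^esub> (?s \<otimes>\<^bsub>R\<^esub> ?s) \<otimes>\<^bsub>R\<^esub> f"
  have nnc: "n \<otimes>\<^bsub>G\<^esub> n \<in> carrier G" using n by simp
  have "components ?v (n \<otimes>\<^bsub>G\<^esub> n \<otimes>\<^bsub>G\<^esub> n) = ?s \<otimes>\<^bsub>R\<^esub> ?s \<otimes>\<^bsub>R\<^esub> ?s"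
    using components_one_plus_mult[OF nnc ssA fc, of "n \<otimes>\<^bsub>G\<^esub> n \<otimes>\<^bsub>G\<^esub> n"] n nnn c shift by simp
  moreover have "components ?v n = ?s \<otimes>\<^bsub>R\<^esub> ?s \<otimes>\<^bsub>R\<^esub> ?t"
    using components_one_plus_mult[OF nnc ssA fc n(1)] n c shift by simp
  ultimately have "n \<otimes>\<^bsub>G\<^esub> n \<otimes>\<^bsub>G\<^esub> n = n"
    using jacobson_radical_unit_component_unique[OF tf M f, of "?s \<otimes>\<^bsub>R\<^esub> ?s" "n \<otimes>\<^bsub>G\<^esub> n \<otimes>\<^bsub>G\<^esub> n" n]
      sss sst n c by simp
  then show False using G.r_cancel_one'[OF n(1) nnc] nn by simp
qed

text \<open>For each maximal ideal, the components outside the identity degree are covered by the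
  previous lemma; subtracting them from the element itself leaves the remaining one.\<close>

lemma graded_ideal_jacobson_radical:
  assumes tf: "torsion_free G"
  shows "graded_ideal R.jacobson_radical"
  unfolding graded_ideal_def
proof (intro conjI ballI impI)
  show "ideal R.jacobson_radical R" by (rule R.ideal_jacobson_radical)
  fix r n
  assume r: "r \<in> component_families G R A" and J: "family_sum G R r \<in> R.jacobson_radical"
    and n: "n \<in> carrier G"
  have "r n \<in> M" if M: "maximalideal M R" for M
  proof -
    interpret M: maximalideal M R by fact
    have other: "r k \<in> M" if "k \<in> carrier G" "k \<noteq> \<one>\<^bsub>G\<^esub>" for k
      using jacobson_radical_component_mem_maximalideal[OF tf J that M] components_family_sum[OF r]
      by simp
    \<comment> \<open>The identity degree may lie outside the support, while the subtraction needs a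
      term there.\<close>
    let ?F = "insert \<one>\<^bsub>G\<^esub> {k \<in> carrier G. r k \<noteq> \<zero>\<^bsub>R\<^esub>}"
    have F: "finite ?F" "?F \<subseteq> carrier G" using r by (auto simp: component_families_def)
    have "finsum R r ?F = family_sum G R r"
      by (rule family_sum_eq_finsum[OF r F, symmetric]) auto
    then have "finsum R r ?F \<in> M" using J M by (auto simp: R.jacobson_radical_def)
    then have "r \<one>\<^bsub>G\<^esub> \<in> M"
      using M.finsum_mem_imp_summand_mem[of ?F "\<one>\<^bsub>G\<^esub>" r] F other component_families_carrier[OF r]
      by auto
    then show ?thesis using other n by blast
  qed
  then show "r n \<in> R.jacobson_radical"
    using component_families_carrier[OF r n] by (simp add: R.jacobson_radical_def)
qed

end

theorem theorem7p1:
  fixes G :: "('g, 'm) monoid_scheme"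
    and R :: "('a, 'r) ring_scheme"
    and A :: "'g \<Rightarrow> 'a set"
  assumes "comm_group G"
    and "torsion_free G"
    and "cring R"
    and "graded_ring G R A"
  shows "graded_ring.graded_ideal G R A (cring.jacobson_radical R)"
proof -
  interpret graded_cring G R A
    using assms(3,4) by (rule graded_cring.intro[rotated])
  show ?thesis using assms(2) by (rule graded_ideal_jacobson_radical)
qed

end
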